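(* Let $R$ be a left Goldie domain, $n\geq 1$ an integer, and $U_n(R)$ the ring of $n\times n$ upper triangular matrices with coefficients in $R$. Then 1. $\mathrm{max.Den}_l(U_n(R))=\{T_l(U_n(R))\}$ and $T_l(U_n(R))=\{a=(a_{ij})\in U_n(R)\mid a_{nn}\neq 0\}$. 2. $\mathfrak{l}^s_{U_n(R)}=\{a=(a_{ij})\in U_n(R)\mid a_{nn}=0\}$. 3. $Q_l^s(U_n(R))=Q_{l,cl}(R)$ (up to ring isomorphism).
   Context: Rings are associative with $1$. A multiplicative subset $S$ of a ring $A$ is a submonoid of $(A,\cdot)$ with $1\in S$, $0\notin S$. It is a left Ore set if $Sr\cap As\neq\emptyset$ for all $r\in A$, $s\in S$; then $\mathrm{ass}(S):=\{r\in A\mid sr=0 \text{ for some } s\in S\}$ is an ideal. A left Ore set $S$ is a left denominator set if $rs=0$ with $r\in A$, $s\in S$ implies $r\in\mathrm{ass}(S)$. $\mathrm{Den}_l(A)$ is the set of left denominator sets of $A$; for $S\in\mathrm{Den}_l(A)$, $S^{-1}A=\{s^{-1}r\mid s\in S,r\in A\}$ is the left localization. $\mathrm{max.Den}_l(A)$ is the set of elements of $\mathrm{Den}_l(A)$ maximal under inclusion. $\mathcal{L}^s_l(A):=\bigcap_{S\in \mathrm{max.Den}_l(A)}S$. $T_l(A)$ is the union of all $S\in\mathrm{Den}_l(A)$ with $S\subseteq\mathcal{L}^s_l(A)$; it is the largest left denominator set of $A$ contained in $\mathcal{L}^s_l(A)$. $Q_l^s(A):=T_l(A)^{-1}A$ and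 $\mathfrak{l}^s_A:=\mathrm{ass}(T_l(A))$. A ring is left Goldie if it contains no infinite direct sum of nonzero left ideals and satisfies the ascending chain condition on left annihilators. For a left Goldie domain $R$, $Q_{l,cl}(R)=(R\setminus\{0\})^{-1}R$ is its classical left quotient ring, a division ring. *)

theory Defs
  imports "HOL-Algebra.QuotRing"
begin

section \<open>Left Goldie domains\<close>

text \<open>The library's \<^locale>\<open>domain\<close> is commutative, and its \<^locale>\<open>ideal\<close> is two-sided.\<close>

locale nc_domain = ring R for R (structure) +
  assumes one_not_zero: "\<one> \<noteq> \<zero>"
    and integral: "\<lbrakk>a \<otimes> b = \<zero>; a \<in> carrier R; b \<in> carrier R\<rbrakk> \<Longrightarrow> a = \<zero> \<or> b = \<zero>"

definition left_ideal :: "'a set \<Rightarrow> ('a, 'm) ring_scheme \<Rightarrow> bool" where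
  "left_ideal I R \<longleftrightarrow>
    additive_subgroup I R \<and> (\<forall>a\<in>carrier R. \<forall>x\<in>I. a \<otimes>\<^bsub>R\<^esub> x \<in> I)"

text \<open>The members of a family of nonzero left ideals whose sum is direct are pairwise distinct, so
  such a family is given by a set of left ideals.\<close>

definition direct_family :: "'a set set \<Rightarrow> ('a, 'm) ring_scheme \<Rightarrow> bool" where
  "direct_family \<I> R \<longleftrightarrow>
    (\<forall>F x. finite F \<and> F \<subseteq> \<I> \<and> (\<forall>I\<in>F. x I \<in> I) \<and> (\<Oplus>\<^bsub>R\<^esub>I\<in>F. x I) = \<zero>\<^bsub>R\<^esub>
      \<longrightarrow> (\<forall>I\<in>F. x I = \<zero>\<^bsub>R\<^esub>))"

definition left_annihilator :: "('a, 'm) ring_scheme \<Rightarrow> 'a set \<Rightarrow> 'a set" where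
  "left_annihilator R X = {a \<in> carrier R. \<forall>x\<in>X. a \<otimes>\<^bsub>R\<^esub> x = \<zero>\<^bsub>R\<^esub>}"

definition left_goldie :: "('a, 'm) ring_scheme \<Rightarrow> bool" where
  "left_goldie R \<longleftrightarrow>
    (\<nexists>\<I>. infinite \<I> \<and> (\<forall>I\<in>\<I>. left_ideal I R \<and> I \<noteq> {\<zero>\<^bsub>R\<^esub>}) \<and> direct_family \<I> R) \<and>
    (\<forall>L :: nat \<Rightarrow> 'a set.
      (\<forall>k. \<exists>X \<subseteq> carrier R. L k = left_annihilator R X) \<and> (\<forall>k. L k \<subseteq> L (Suc k))
      \<longrightarrow> (\<exists>N. \<forall>k\<ge>N. L k = L N))"


section \<open>Left denominator sets\<close>

definition multiplicative_subset :: "('a, 'm) ring_scheme \<Rightarrow> 'a set \<Rightarrow> bool" where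
  "multiplicative_subset A S \<longleftrightarrow> submonoid S A \<and> \<zero>\<^bsub>A\<^esub> \<notin> S"

text \<open>The cosets \<open>S #> r\<close> and \<open>carrier A #> s\<close> are multiplicative: they are $Sr$ and $As$.\<close>

definition left_ore_set :: "('a, 'm) ring_scheme \<Rightarrow> 'a set \<Rightarrow> bool" where
  "left_ore_set A S \<longleftrightarrow> multiplicative_subset A S \<and>
    (\<forall>r\<in>carrier A. \<forall>s\<in>S. (S #>\<^bsub>A\<^esub> r) \<inter> (carrier A #>\<^bsub>A\<^esub> s) \<noteq> {})"

definition ass :: "('a, 'm) ring_scheme \<Rightarrow> 'a set \<Rightarrow> 'a set" where
  "ass A S = {r \<in> carrier A. \<exists>s\<in>S. s \<otimes>\<^bsub>A\<^esub> r = \<zero>\<^bsub>A\<^esub>}"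

definition Den_l :: "('a, 'm) ring_scheme \<Rightarrow> 'a set set" where
  "Den_l A = {S. left_ore_set A S \<and>
    (\<forall>r\<in>carrier A. \<forall>s\<in>S. r \<otimes>\<^bsub>A\<^esub> s = \<zero>\<^bsub>A\<^esub> \<longrightarrow> r \<in> ass A S)}"

definition max_Den_l :: "('a, 'm) ring_scheme \<Rightarrow> 'a set set" where
  "max_Den_l A = {S \<in> Den_l A. \<forall>S'\<in>Den_l A. S \<subseteq> S' \<longrightarrow> S' = S}"

definition Ls_l :: "('a, 'm) ring_scheme \<Rightarrow> 'a set" where
  "Ls_l A = \<Inter> (max_Den_l A)"

definition T_l :: "('a, 'm) ring_scheme \<Rightarrow> 'a set" where
  "T_l A = \<Union> {S \<in> Den_l A. S \<subseteq> Ls_l A}"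


section \<open>Left localization\<close>

text \<open>The pair \<open>(s, r)\<close> stands for $s^{-1}r$. Two fractions are equal iff they can be expanded
  to a common denominator in \<open>S\<close> with the same numerator; the expanding factors \<open>c\<close>, \<open>d\<close> are only
  required to be in \<open>A\<close>. This is an equivalence relation if \<open>S\<close> is a left denominator set.\<close>

definition frac_rel :: "('a, 'm) ring_scheme \<Rightarrow> 'a set \<Rightarrow> (('a \<times> 'a) \<times> ('a \<times> 'a)) set" where
  "frac_rel A S = {((s, r), (t, q)).
    s \<in> S \<and> r \<in> carrier A \<and> t \<in> S \<and> q \<in> carrier A \<and>
    (\<exists>c\<in>carrier A. \<exists>d\<in>carrier A.
      c \<otimes>\<^bsub>A\<^esub> s = d \<otimes>\<^bsub>A\<^esub> t \<and> c \<otimes>\<^bsub>A\<^esub> s \<in> S \<and> c \<otimes>\<^bsub>A\<^esub> r = d \<otimes>\<^bsub>A\<^esub> q)}"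

definition frac :: "('a, 'm) ring_scheme \<Rightarrow> 'a set \<Rightarrow> 'a \<Rightarrow> 'a \<Rightarrow> ('a \<times> 'a) set" where
  "frac A S s r = frac_rel A S `` {(s, r)}"

text \<open>Sums and products of classes are computed on representatives by
  $s^{-1}r + t^{-1}q = (cs)^{-1}(cr + dq)$ if $cs = dt \in S$, and
  $s^{-1}r \cdot t^{-1}q = (ws)^{-1}(cq)$ if $wr = ct$ with $w \in S$. If \<open>S\<close> is a left
  denominator set, then such $c$, $d$, $w$ exist and the resulting class does not depend on them or
  on the representatives, so that each union below is the union of a single class.\<close>

definition left_localization ::
    "('a, 'm) ring_scheme \<Rightarrow> 'a set \<Rightarrow> ('a \<times> 'a) set ring" where
  "left_localization A S = \<lparr>
    carrier = (S \<times> carrier A) // frac_rel A S,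
    mult = (\<lambda>X Y. \<Union> {frac A S (w \<otimes>\<^bsub>A\<^esub> s) (c \<otimes>\<^bsub>A\<^esub> q) | s r t q w c.
      (s, r) \<in> X \<and> (t, q) \<in> Y \<and> w \<in> S \<and> c \<in> carrier A \<and> w \<otimes>\<^bsub>A\<^esub> r = c \<otimes>\<^bsub>A\<^esub> t}),
    one = frac A S \<one>\<^bsub>A\<^esub> \<one>\<^bsub>A\<^esub>,
    zero = frac A S \<one>\<^bsub>A\<^esub> \<zero>\<^bsub>A\<^esub>,
    add = (\<lambda>X Y. \<Union> {frac A S (c \<otimes>\<^bsub>A\<^esub> s) (c \<otimes>\<^bsub>A\<^esub> r \<oplus>\<^bsub>A\<^esub> d \<otimes>\<^bsub>A\<^esub> q) | s r t q c d.
      (s, r) \<in> X \<and> (t, q) \<in> Y \<and> c \<in> carrier A \<and> d \<in> carrier A \<and>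
      c \<otimes>\<^bsub>A\<^esub> s = d \<otimes>\<^bsub>A\<^esub> t \<and> c \<otimes>\<^bsub>A\<^esub> s \<in> S})\<rparr>"

definition Qs_l :: "('a, 'm) ring_scheme \<Rightarrow> ('a \<times> 'a) set ring" where
  "Qs_l A = left_localization A (T_l A)"

definition ls_ideal :: "('a, 'm) ring_scheme \<Rightarrow> 'a set" where
  "ls_ideal A = ass A (T_l A)"

definition Q_lcl :: "('a, 'm) ring_scheme \<Rightarrow> ('a \<times> 'a) set ring" where
  "Q_lcl R = left_localization R (carrier R - {\<zero>\<^bsub>R\<^esub>})"


section \<open>Upper triangular matrices\<close>

text \<open>Rows and columns are indexed by \<open>{1..n}\<close>; entries outside this range are set to zero so that
  a matrix is represented by exactly one function.\<close>

definition upper_triangular_ring ::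
    "nat \<Rightarrow> ('a, 'm) ring_scheme \<Rightarrow> (nat \<Rightarrow> nat \<Rightarrow> 'a) ring" where
  "upper_triangular_ring n R = \<lparr>
    carrier = {a. (\<forall>i j. a i j \<in> carrier R) \<and>
                  (\<forall>i j. \<not> (1 \<le> i \<and> i \<le> j \<and> j \<le> n) \<longrightarrow> a i j = \<zero>\<^bsub>R\<^esub>)},
    mult = (\<lambda>a b i j. \<Oplus>\<^bsub>R\<^esub>k\<in>{1..n}. a i k \<otimes>\<^bsub>R\<^esub> b k j),
    one = (\<lambda>i j. if i = j \<and> i \<in> {1..n} then \<one>\<^bsub>R\<^esub> else \<zero>\<^bsub>R\<^esub>),
    zero = (\<lambda>i j. \<zero>\<^bsub>R\<^esub>),
    add = (\<lambda>a b i j. a i j \<oplus>\<^bsub>R\<^esub> b i j)\<rparr>"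

end

theory Submission
  imports Defs
begin

text \<open>Two nonzero elements \<open>r\<close>, \<open>s\<close> of a left Goldie domain have a common nonzero left multiple, as
  otherwise the left ideals $Rrs^k$ form an infinite direct sum; so \<open>R - {0}\<close> is a left Ore set.
  The map $\varphi(a) = a_{nn}$ is a ring homomorphism, and $(xE_{nn})a = (x\varphi(a))E_{nn}$ for
  $x \in R$. Hence every equation in \<open>R\<close> between images under $\varphi$ lifts to $U_n(R)$ after left
  multiplication by $E_{nn}$, and the Ore condition, the denominator condition and the fractions of
  \<open>R - {0}\<close> carry over to its preimage. Conversely, if a left denominator set \<open>S\<close> contains \<open>s\<close> with
  $s_{nn} = 0$, then $E_{nn}s = 0$ gives $t \in S$ with $tE_{nn} = 0$. The Ore condition for
  $E_{kn}$ and \<open>t\<close> gives $s_k \in S$ whose \<open>k\<close>-th diagonal entry is zero, and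
  $s_1 s_2 \cdots s_n = 0$ lies in \<open>S\<close>, a contradiction.\<close>

section \<open>The left Ore condition in left Goldie domains\<close>

lemma (in ring) left_ideal_principal:
  assumes "x \<in> carrier R"
  shows "left_ideal (carrier R #> x) R"
  unfolding left_ideal_def
proof (intro conjI ballI)
  show "additive_subgroup (carrier R #> x) R"
  proof (intro additive_subgroup.intro add.subgroupI)
    show "carrier R #> x \<subseteq> carrier R" "carrier R #> x \<noteq> {}"
      using assms by (auto simp: r_coset_def)
  next
    fix y assume "y \<in> carrier R #> x"
    then obtain a where "a \<in> carrier R" "y = a \<otimes> x" by (auto simp: r_coset_def)
    then have "\<ominus> y = (\<ominus> a) \<otimes> x" "\<ominus> a \<in> carrier R" using assms by (simp_all add: l_minus)
    then show "\<ominus> y \<in> carrier R #> x" by (auto simp: r_coset_def)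
  next
    fix y z assume "y \<in> carrier R #> x" "z \<in> carrier R #> x"
    then obtain a b where "a \<in> carrier R" "b \<in> carrier R" "y = a \<otimes> x" "z = b \<otimes> x"
      by (auto simp: r_coset_def)
    then have "y \<oplus> z = (a \<oplus> b) \<otimes> x" "a \<oplus> b \<in> carrier R" using assms by (simp_all add: l_distr)
    then show "y \<oplus> z \<in> carrier R #> x" by (auto simp: r_coset_def)
  qed
next
  fix a y assume a: "a \<in> carrier R" and "y \<in> carrier R #> x"
  then obtain b where b: "b \<in> carrier R" "y = b \<otimes> x" by (auto simp: r_coset_def)
  then have "a \<otimes> y = (a \<otimes> b) \<otimes> x" "a \<otimes> b \<in> carrier R" using a assms by (simp_all add: m_assoc)
  then show "a \<otimes> y \<in> carrier R #> x" by (auto simp: r_coset_def)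
qed

context nc_domain
begin

lemma pow_nonzero:
  assumes "s \<in> carrier R" "s \<noteq> \<zero>"
  shows "s [^] (k::nat) \<noteq> \<zero>"
proof (induction k)
  case 0
  then show ?case using one_not_zero by simp
next
  case (Suc k)
  then show ?case using assms integral[of "s [^] k" s] by auto
qed

lemma right_cancel:
  assumes "a \<otimes> c = b \<otimes> c" "a \<in> carrier R" "b \<in> carrier R" "c \<in> carrier R" "c \<noteq> \<zero>"
  shows "a = b"
proof -
  have "(a \<ominus> b) \<otimes> c = a \<otimes> c \<ominus> b \<otimes> c"
    using assms(2-4) by (simp add: a_minus_def l_distr l_minus)
  also have "\<dots> = \<zero>" using assms(1-4) by (simp add: a_minus_def r_neg)
  finally have "a \<ominus> b = \<zero>" using integral assms by blast
  then show ?thesis using assms(2,3) minus_equality[of a "\<ominus> b"] by (simp add: a_minus_def)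
qed

text \<open>All summands except the one for \<open>k = 0\<close> have a right factor
  \<open>s\<close>, so the relation reads $Xs + a_0 r = 0$ and \<open>disj\<close> forces $a_0 = 0$.
  Cancelling \<open>s\<close> leaves a shorter relation between the shifted coefficients.\<close>

lemma left_independent_powers:
  assumes r: "r \<in> carrier R" and s: "s \<in> carrier R" "s \<noteq> \<zero>"
    and disj: "\<And>u v. \<lbrakk>u \<in> carrier R; v \<in> carrier R; u \<otimes> r = v \<otimes> s\<rbrakk> \<Longrightarrow> u = \<zero>"
    and a: "\<And>k. a k \<in> carrier R"
    and "(\<Oplus>k\<in>{..m::nat}. a k \<otimes> (r \<otimes> s [^] k)) = \<zero>"
  shows "\<forall>k\<le>m. a k = \<zero>"
  using a assms(6)
proof (induction m arbitrary: a)
  case 0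
  then have "a 0 \<otimes> r = \<zero> \<otimes> s" using r s by simp
  then show ?case using disj 0 by auto
next
  case (Suc m)
  define X where "X = (\<Oplus>k\<in>{..m}. a (Suc k) \<otimes> (r \<otimes> s [^] k))"
  have X: "X \<in> carrier R" unfolding X_def using Suc.prems r s by (intro finsum_closed) auto
  have "X \<otimes> s = (\<Oplus>k\<in>{..m}. a (Suc k) \<otimes> (r \<otimes> s [^] k) \<otimes> s)"
    unfolding X_def using Suc.prems(1) r s by (intro finsum_ldistr) auto
  also have "\<dots> = (\<Oplus>k\<in>{..m}. a (Suc k) \<otimes> (r \<otimes> s [^] Suc k))"
    using Suc.prems(1) r s by (intro finsum_cong') (auto simp: m_assoc)
  finally have Xs: "X \<otimes> s \<oplus> a 0 \<otimes> r = \<zero>"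
    using Suc.prems finsum_Suc2[of "\<lambda>k. a k \<otimes> (r \<otimes> s [^] k)" m] r s by (simp add: Pi_def)
  then have "a 0 \<otimes> r = (\<ominus> X) \<otimes> s"
    using X r s Suc.prems(1) by (metis l_minus m_closed minus_equality a_comm minus_minus)
  then have a0: "a 0 = \<zero>" using disj X Suc.prems(1) by blast
  then have "X \<otimes> s = \<zero>" using Xs X r s by simp
  then have "X = \<zero>" using integral X s by blast
  then have "\<forall>k\<le>m. a (Suc k) = \<zero>"
    using Suc.IH[of "\<lambda>k. a (Suc k)"] Suc.prems(1) unfolding X_def by blast
  then show ?case using a0 by (metis Suc_le_mono not0_implies_Suc)
qed

text \<open>The content is \<open>u \<noteq> \<zero>\<close>, since \<open>u = v = \<zero>\<close>
  always solves the equation. Its negation is the hypothesis \<open>disj\<close> of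
  \<open>left_independent_powers\<close>, which makes the sum of the ideals \<open>J k\<close>
  direct.\<close>

lemma left_goldie_imp_left_ore:
  assumes goldie: "left_goldie R" and r: "r \<in> carrier R" and s: "s \<in> carrier R" "s \<noteq> \<zero>"
  shows "\<exists>u\<in>carrier R. \<exists>v\<in>carrier R. u \<noteq> \<zero> \<and> u \<otimes> r = v \<otimes> s"
proof (rule ccontr)
  assume neg: "\<not> ?thesis"
  then have disj: "\<And>u v. \<lbrakk>u \<in> carrier R; v \<in> carrier R; u \<otimes> r = v \<otimes> s\<rbrakk> \<Longrightarrow> u = \<zero>"
    by blast
  \<comment> \<open>If \<open>r\<close> were zero,
    \<open>\<one> \<otimes> r = \<zero> \<otimes> s\<close> would contradict
    \<open>disj\<close>.\<close>
  have r0: "r \<noteq> \<zero>"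
    using disj[of \<one> \<zero>] one_not_zero s by auto
  define x where "x k = r \<otimes> s [^] k" for k :: nat
  have x: "x k \<in> carrier R" "x k \<noteq> \<zero>" for k
    using r r0 s pow_nonzero integral unfolding x_def by (auto, metis nat_pow_closed)
  define J where "J k = carrier R #> x k" for k
  have xJ: "x k \<in> J k" for k
    using x[of k] unfolding J_def r_coset_def by (auto intro!: bexI[of _ \<one>])
  have ideal: "left_ideal (J k) R" "J k \<noteq> {\<zero>}" for k
    using left_ideal_principal x xJ[of k] unfolding J_def by auto
  \<comment> \<open>Distinctness makes the set \<open>range J\<close> infinite. An equality would
    give, after cancelling $s^i$, that \<open>r\<close> is a left multiple of \<open>s\<close>,
    against \<open>disj\<close> with \<open>u = \<one>\<close>.\<close>
  have "J i \<noteq> J j" if "i < j" for i j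
  proof
    assume "J i = J j"
    then obtain b where b: "b \<in> carrier R" "x i = b \<otimes> x j"
      using xJ[of i] by (auto simp: J_def r_coset_def)
    \<comment> \<open>The exponent \<open>j - i\<close> becomes \<open>Suc d\<close>, so that one
      factor \<open>s\<close> can be split off on the right.\<close>
    define d where "d = j - Suc i"
    with that have d: "j = Suc d + i" by simp
    have "r \<otimes> s [^] i = (b \<otimes> (r \<otimes> s [^] Suc d)) \<otimes> s [^] i"
      using b r s nat_pow_mult[OF s(1), of "Suc d" i] unfolding x_def d
      by (simp add: m_assoc del: nat_pow_Suc)
    then have "r = b \<otimes> (r \<otimes> s [^] Suc d)"
      using b r s pow_nonzero by (intro right_cancel[of r "s [^] i"]) auto
    then have "\<one> \<otimes> r = (b \<otimes> (r \<otimes> s [^] d)) \<otimes> s" using b r s by (simp add: m_assoc)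
    then show False using disj b r s one_not_zero by (metis m_closed nat_pow_closed one_closed)
  qed
  then have inj: "inj J" by (metis injI linorder_neqE_nat)
  have "direct_family (range J) R"
    unfolding direct_family_def
  proof (intro allI impI, elim conjE)
    fix F y
    assume F: "finite F" "F \<subseteq> range J" and y: "\<forall>I\<in>F. y I \<in> I" and sum: "(\<Oplus>I\<in>F. y I) = \<zero>"
    \<comment> \<open>\<open>K\<close> turns the sum over the ideals in \<open>F\<close> into a sum
      over exponents.\<close>
    define K where "K = {k. J k \<in> F}"
    have FK: "F = J ` K" using F(2) by (auto simp: K_def)
    have "finite K" using F(1) inj unfolding K_def by (metis finite_vimageI vimage_def)
    then obtain m where m: "K \<subseteq> {..m}" using finite_nat_set_iff_bounded_le by auto
    have "\<forall>k\<in>K. \<exists>b\<in>carrier R. y (J k) = b \<otimes> x k"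
      using y by (auto simp: K_def J_def r_coset_def)
    then obtain b where b: "\<And>k. k \<in> K \<Longrightarrow> b k \<in> carrier R \<and> y (J k) = b k \<otimes> x k"
      by metis
    \<comment> \<open>Padding by zero extends the sum over \<open>K\<close> to the initial segment
      \<open>{..m}\<close> that \<open>left_independent_powers\<close> handles.\<close>
    define a where "a k = (if k \<in> K then b k else \<zero>)" for k
    have a: "a k \<in> carrier R" for k using b by (auto simp: a_def)
    have "(\<Oplus>k\<in>{..m}. a k \<otimes> x k) = (\<Oplus>k\<in>K. y (J k))"
      using m a b x by (intro add.finprod_mono_neutral_cong_right) (auto simp: a_def)
    also have "\<dots> = (\<Oplus>I\<in>F. y I)"
      unfolding FK using b x inj by (intro finsum_reindex[symmetric]) (auto intro: inj_on_subset)
    finally have "(\<Oplus>k\<in>{..m}. a k \<otimes> (r \<otimes> s [^] k)) = \<zero>" unfolding sum x_def .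
    with r s disj a have "\<forall>k\<le>m. a k = \<zero>" by (rule left_independent_powers)
    then have "\<And>k. k \<in> K \<Longrightarrow> y (J k) = \<zero>"
      using m b x by (auto simp: a_def split: if_splits)
    then show "\<forall>I\<in>F. y I = \<zero>" unfolding FK by blast
  qed
  moreover have "infinite (range J)" using inj by (simp add: finite_image_iff)
  moreover have "\<forall>I\<in>range J. left_ideal I R \<and> I \<noteq> {\<zero>}" using ideal by simp
  moreover have "\<nexists>\<I>. infinite \<I> \<and> (\<forall>I\<in>\<I>. left_ideal I R \<and> I \<noteq> {\<zero>}) \<and> direct_family \<I> R"
    using goldie unfolding left_goldie_def by (rule conjunct1)
  ultimately show False by metis
qed

end

section \<open>Localizations and surjections\<close>

text \<open>An expansion to a common denominator maps forward under \<open>\<phi>\<close>. Backward,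
  \<open>c\<close> and \<open>d\<close> are replaced by \<open>\<psi> c\<close> and
  \<open>\<psi> d\<close>: by \<open>\<psi>\<phi>\<close> the products with these depend on the
  other factor only through \<open>\<phi>\<close>, so equations in \<open>R\<close> become equations
  in \<open>A\<close>.\<close>

lemma frac_rel_image:
  fixes A (structure)
  assumes mult: "\<And>x y. \<lbrakk>x \<in> carrier A; y \<in> carrier A\<rbrakk> \<Longrightarrow> x \<otimes> y \<in> carrier A"
    and \<phi>: "\<phi> \<in> ring_hom A R"
    and \<psi>: "\<And>x. x \<in> carrier R \<Longrightarrow> \<psi> x \<in> carrier A" "\<And>x. x \<in> carrier R \<Longrightarrow> \<phi> (\<psi> x) = x"
    and \<psi>\<phi>: "\<And>x a. \<lbrakk>x \<in> carrier R; a \<in> carrier A\<rbrakk> \<Longrightarrow> \<psi> x \<otimes> a = \<psi> (x \<otimes>\<^bsub>R\<^esub> \<phi> a)"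
    and S: "S = {a \<in> carrier A. \<phi> a \<in> T}"
    and in_A: "s \<in> carrier A" "r \<in> carrier A" "t \<in> carrier A" "q \<in> carrier A"
  shows "((s, r), (t, q)) \<in> frac_rel A S \<longleftrightarrow> ((\<phi> s, \<phi> r), (\<phi> t, \<phi> q)) \<in> frac_rel R T"
proof
  assume "((s, r), (t, q)) \<in> frac_rel A S"
  then obtain c d where cd: "s \<in> S" "t \<in> S" "c \<in> carrier A" "d \<in> carrier A"
      "c \<otimes> s = d \<otimes> t" "c \<otimes> s \<in> S" "c \<otimes> r = d \<otimes> q"
    by (auto simp: frac_rel_def)
  then have "\<phi> c \<otimes>\<^bsub>R\<^esub> \<phi> s = \<phi> d \<otimes>\<^bsub>R\<^esub> \<phi> t" "\<phi> c \<otimes>\<^bsub>R\<^esub> \<phi> r = \<phi> d \<otimes>\<^bsub>R\<^esub> \<phi> q" "\<phi> c \<otimes>\<^bsub>R\<^esub> \<phi> s \<in> T"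
    using in_A S by (auto simp flip: ring_hom_mult[OF \<phi>])
  then show "((\<phi> s, \<phi> r), (\<phi> t, \<phi> q)) \<in> frac_rel R T"
    using cd in_A ring_hom_closed[OF \<phi>] S unfolding frac_rel_def by blast
next
  assume "((\<phi> s, \<phi> r), (\<phi> t, \<phi> q)) \<in> frac_rel R T"
  then obtain c d where cd: "\<phi> s \<in> T" "\<phi> t \<in> T" "c \<in> carrier R" "d \<in> carrier R"
      "c \<otimes>\<^bsub>R\<^esub> \<phi> s = d \<otimes>\<^bsub>R\<^esub> \<phi> t" "c \<otimes>\<^bsub>R\<^esub> \<phi> s \<in> T" "c \<otimes>\<^bsub>R\<^esub> \<phi> r = d \<otimes>\<^bsub>R\<^esub> \<phi> q"
    by (auto simp: frac_rel_def)
  have "\<psi> c \<otimes> s = \<psi> d \<otimes> t" "\<psi> c \<otimes> r = \<psi> d \<otimes> q"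
    using cd in_A \<psi>\<phi> by simp_all
  moreover have "\<psi> c \<otimes> s \<in> S"
    using cd in_A \<psi> mult ring_hom_mult[OF \<phi>] unfolding S by auto
  ultimately show "((s, r), (t, q)) \<in> frac_rel A S"
    using cd in_A \<psi>(1) S unfolding frac_rel_def by blast
qed

text \<open>Sums and products of classes are unions over all representatives and all auxiliary factors,
  and both sides range over the same data up to $\varphi$; so no well-definedness is needed.\<close>

lemma left_localization_iso:
  fixes A (structure)
  assumes R: "ring R" and T: "submonoid T R" and one_A: "\<one> \<in> carrier A"
    and mult: "\<And>x y. \<lbrakk>x \<in> carrier A; y \<in> carrier A\<rbrakk> \<Longrightarrow> x \<otimes> y \<in> carrier A"
    and add: "\<And>x y. \<lbrakk>x \<in> carrier A; y \<in> carrier A\<rbrakk> \<Longrightarrow> x \<oplus> y \<in> carrier A"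
    and \<phi>: "\<phi> \<in> ring_hom A R"
    and \<psi>: "\<And>x. x \<in> carrier R \<Longrightarrow> \<psi> x \<in> carrier A" "\<And>x. x \<in> carrier R \<Longrightarrow> \<phi> (\<psi> x) = x"
    and \<psi>\<phi>: "\<And>x a. \<lbrakk>x \<in> carrier R; a \<in> carrier A\<rbrakk> \<Longrightarrow> \<psi> x \<otimes> a = \<psi> (x \<otimes>\<^bsub>R\<^esub> \<phi> a)"
    and S: "S = {a \<in> carrier A. \<phi> a \<in> T}"
  shows "left_localization A S \<simeq> left_localization R T"
proof -
  interpret R: ring R by fact
  interpret T: submonoid T R by fact
  note hom = ring_hom_closed[OF \<phi>] ring_hom_mult[OF \<phi>] ring_hom_add[OF \<phi>] ring_hom_one[OF \<phi>]
  note rel = frac_rel_image[OF mult \<phi> \<psi> \<psi>\<phi> S]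
  \<comment> \<open>A class is a set of pairs, so the pointwise image defines a map without a choice
    of representatives.\<close>
  define h where "h X = map_prod \<phi> \<phi> ` X" for X
  have rel_dom: "((s, r), (t, q)) \<in> frac_rel A S \<Longrightarrow> t \<in> S \<and> q \<in> carrier A \<and> s \<in> S \<and> r \<in> carrier A"
    for s r t q by (auto simp: frac_rel_def)
  have relR_dom: "((s, r), (t, q)) \<in> frac_rel R T \<Longrightarrow> t \<in> T \<and> q \<in> carrier R \<and> s \<in> T \<and> r \<in> carrier R"
    for s r t q by (auto simp: frac_rel_def)
  have SA: "s \<in> S \<Longrightarrow> s \<in> carrier A" "s \<in> S \<Longrightarrow> \<phi> s \<in> T" for s using S by auto
  have \<psi>S: "x \<in> T \<Longrightarrow> \<psi> x \<in> S" for x using S \<psi> by auto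
  have S_mult: "x \<in> S \<Longrightarrow> y \<in> S \<Longrightarrow> x \<otimes> y \<in> S" for x y
    using mult hom(2) T.m_closed by (simp add: S)
  \<comment> \<open>The image of a class is a whole class: a pair \<open>(t, q)\<close> over
    \<open>R\<close> is hit by \<open>(\<psi> t, \<psi> q)\<close>, which \<open>rel\<close> puts
    into the class of \<open>(s, r)\<close>.\<close>
  have h_frac: "h (frac A S s r) = frac R T (\<phi> s) (\<phi> r)" if sr: "s \<in> S" "r \<in> carrier A" for s r
  proof (intro equalityI subsetI)
    fix p assume "p \<in> h (frac A S s r)"
    then obtain t q where tq: "p = (\<phi> t, \<phi> q)" "((s, r), (t, q)) \<in> frac_rel A S"
      by (auto simp: h_def frac_def)
    then show "p \<in> frac R T (\<phi> s) (\<phi> r)"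
      using rel[of s r t q] rel_dom SA by (auto simp: frac_def)
  next
    fix p assume "p \<in> frac R T (\<phi> s) (\<phi> r)"
    then obtain t q where tq: "p = (t, q)" "((\<phi> s, \<phi> r), (t, q)) \<in> frac_rel R T"
      by (cases p) (auto simp: frac_def)
    then have "t \<in> carrier R" "q \<in> carrier R" using relR_dom by auto
    then have "((s, r), (\<psi> t, \<psi> q)) \<in> frac_rel A S" "map_prod \<phi> \<phi> (\<psi> t, \<psi> q) = p"
      using rel[of s r "\<psi> t" "\<psi> q"] tq sr SA \<psi> by auto
    then show "p \<in> h (frac A S s r)"
      unfolding h_def frac_def by blast
  qed
  \<comment> \<open>For products and sums it therefore suffices to compare the families of classes
    that are united.\<close>
  have h_Union: "h (\<Union> \<X>) = \<Union> (h ` \<X>)" for \<X> by (auto simp: h_def)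
  have carrier: "carrier (left_localization A S) = {frac A S s r | s r. s \<in> S \<and> r \<in> carrier A}"
    "carrier (left_localization R T) = {frac R T s r | s r. s \<in> T \<and> r \<in> carrier R}"
    by (auto simp: left_localization_def quotient_def frac_def)
  have class_dom: "s \<in> S \<and> r \<in> carrier A"
    if "X \<in> carrier (left_localization A S)" "(s, r) \<in> X" for X s r
    using that rel_dom by (auto simp: carrier frac_def)
  have "h \<in> ring_iso (left_localization A S) (left_localization R T)"
  proof (rule ring_iso_memI)
    fix X assume "X \<in> carrier (left_localization A S)"
    then show "h X \<in> carrier (left_localization R T)"
      using h_frac SA hom(1) by (fastforce simp: carrier)
  next
    fix X Y
    assume X: "X \<in> carrier (left_localization A S)" and Y: "Y \<in> carrier (left_localization A S)"
    note XY = class_dom[OF X] class_dom[OF Y]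
    have "h ` {frac A S (w \<otimes> s) (c \<otimes> q) | s r t q w c.
        (s, r) \<in> X \<and> (t, q) \<in> Y \<and> w \<in> S \<and> c \<in> carrier A \<and> w \<otimes> r = c \<otimes> t} =
      {frac R T (w \<otimes>\<^bsub>R\<^esub> s) (c \<otimes>\<^bsub>R\<^esub> q) | s r t q w c.
        (s, r) \<in> h X \<and> (t, q) \<in> h Y \<and> w \<in> T \<and> c \<in> carrier R \<and> w \<otimes>\<^bsub>R\<^esub> r = c \<otimes>\<^bsub>R\<^esub> t}"
      (is "h ` ?L = ?R")
    proof (intro equalityI subsetI)
      fix Z assume "Z \<in> h ` ?L"
      then obtain s r t q w c where Z: "Z = h (frac A S (w \<otimes> s) (c \<otimes> q))"
        and el: "(s, r) \<in> X" "(t, q) \<in> Y" "w \<in> S" "c \<in> carrier A" "w \<otimes> r = c \<otimes> t"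
        by blast
      have dom: "s \<in> S" "r \<in> carrier A" "t \<in> S" "q \<in> carrier A"
        using XY el(1,2) by blast+
      have "\<phi> w \<otimes>\<^bsub>R\<^esub> \<phi> r = \<phi> c \<otimes>\<^bsub>R\<^esub> \<phi> t"
        using el dom SA(1) by (metis hom(2))
      moreover have "(\<phi> s, \<phi> r) \<in> h X" "(\<phi> t, \<phi> q) \<in> h Y" using el by (force simp: h_def)+
      moreover have "Z = frac R T (\<phi> w \<otimes>\<^bsub>R\<^esub> \<phi> s) (\<phi> c \<otimes>\<^bsub>R\<^esub> \<phi> q)"
        using h_frac[of "w \<otimes> s" "c \<otimes> q"] el(3,4) dom SA(1) S_mult mult unfolding Z
        by (simp add: hom(2))
      ultimately show "Z \<in> ?R" using el(3,4) SA(2) hom(1) by blast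
    next
      fix Z assume "Z \<in> ?R"
      then obtain s' r' t' q' w c where Z: "Z = frac R T (w \<otimes>\<^bsub>R\<^esub> s') (c \<otimes>\<^bsub>R\<^esub> q')"
        and el': "(s', r') \<in> h X" "(t', q') \<in> h Y" "w \<in> T" "c \<in> carrier R"
          "w \<otimes>\<^bsub>R\<^esub> r' = c \<otimes>\<^bsub>R\<^esub> t'"
        by blast
      then obtain s r t q where el: "(s, r) \<in> X" "(t, q) \<in> Y" "s' = \<phi> s" "r' = \<phi> r" "t' = \<phi> t" "q' = \<phi> q"
        by (auto simp: h_def)
      have dom: "s \<in> S" "r \<in> carrier A" "t \<in> S" "q \<in> carrier A"
        using XY el(1,2) by blast+
      \<comment> \<open>By \<open>\<psi>\<phi>\<close> both sides are values of
        \<open>\<psi>\<close>, taken at the two sides of the given equation in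
        \<open>R\<close>.\<close>
      have "\<psi> w \<otimes> r = \<psi> c \<otimes> t" using el el' dom SA(1) by (simp add: \<psi>\<phi>)
      moreover have "Z = h (frac A S (\<psi> w \<otimes> s) (\<psi> c \<otimes> q))"
        using h_frac[of "\<psi> w \<otimes> s" "\<psi> c \<otimes> q"] el(3-6) el'(3,4) dom SA(1) S_mult \<psi>S mult \<psi>
        unfolding Z by (simp add: hom(2))
      moreover have "frac A S (\<psi> w \<otimes> s) (\<psi> c \<otimes> q) \<in> ?L"
        using calculation(1) el(1,2) \<psi>S[OF el'(3)] \<psi>(1)[OF el'(4)] by blast
      ultimately show "Z \<in> h ` ?L" by (intro image_eqI)
    qed
    then show "h (X \<otimes>\<^bsub>left_localization A S\<^esub> Y) = h X \<otimes>\<^bsub>left_localization R T\<^esub> h Y"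
      by (simp add: left_localization_def h_Union)
    \<comment> \<open>Sums follow the same pattern, with both \<open>c\<close> and \<open>d\<close>
      mapped by \<open>\<phi>\<close> or lifted by \<open>\<psi>\<close>.\<close>
    have "h ` {frac A S (c \<otimes> s) (c \<otimes> r \<oplus> d \<otimes> q) | s r t q c d.
        (s, r) \<in> X \<and> (t, q) \<in> Y \<and> c \<in> carrier A \<and> d \<in> carrier A \<and> c \<otimes> s = d \<otimes> t \<and> c \<otimes> s \<in> S} =
      {frac R T (c \<otimes>\<^bsub>R\<^esub> s) (c \<otimes>\<^bsub>R\<^esub> r \<oplus>\<^bsub>R\<^esub> d \<otimes>\<^bsub>R\<^esub> q) | s r t q c d.
        (s, r) \<in> h X \<and> (t, q) \<in> h Y \<and> c \<in> carrier R \<and> d \<in> carrier R \<and>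
        c \<otimes>\<^bsub>R\<^esub> s = d \<otimes>\<^bsub>R\<^esub> t \<and> c \<otimes>\<^bsub>R\<^esub> s \<in> T}"
      (is "h ` ?L = ?R")
    proof (intro equalityI subsetI)
      fix Z assume "Z \<in> h ` ?L"
      then obtain s r t q c d where Z: "Z = h (frac A S (c \<otimes> s) (c \<otimes> r \<oplus> d \<otimes> q))"
        and el: "(s, r) \<in> X" "(t, q) \<in> Y" "c \<in> carrier A" "d \<in> carrier A"
          "c \<otimes> s = d \<otimes> t" "c \<otimes> s \<in> S"
        by blast
      have dom: "s \<in> S" "r \<in> carrier A" "t \<in> S" "q \<in> carrier A"
        using XY el(1,2) by blast+
      have "\<phi> c \<otimes>\<^bsub>R\<^esub> \<phi> s = \<phi> d \<otimes>\<^bsub>R\<^esub> \<phi> t" "\<phi> c \<otimes>\<^bsub>R\<^esub> \<phi> s \<in> T"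
        using el dom SA by (metis hom(2))+
      moreover have "(\<phi> s, \<phi> r) \<in> h X" "(\<phi> t, \<phi> q) \<in> h Y" using el by (force simp: h_def)+
      moreover have "Z = frac R T (\<phi> c \<otimes>\<^bsub>R\<^esub> \<phi> s) (\<phi> c \<otimes>\<^bsub>R\<^esub> \<phi> r \<oplus>\<^bsub>R\<^esub> \<phi> d \<otimes>\<^bsub>R\<^esub> \<phi> q)"
        using h_frac[of "c \<otimes> s" "c \<otimes> r \<oplus> d \<otimes> q"] el(3,4,6) dom SA(1) mult add
        unfolding Z by (simp add: hom(2,3))
      ultimately show "Z \<in> ?R" using el(3,4) hom(1) by blast
    next
      fix Z assume "Z \<in> ?R"
      then obtain s' r' t' q' c d where Z: "Z = frac R T (c \<otimes>\<^bsub>R\<^esub> s') (c \<otimes>\<^bsub>R\<^esub> r' \<oplus>\<^bsub>R\<^esub> d \<otimes>\<^bsub>R\<^esub> q')"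
        and el': "(s', r') \<in> h X" "(t', q') \<in> h Y" "c \<in> carrier R" "d \<in> carrier R"
          "c \<otimes>\<^bsub>R\<^esub> s' = d \<otimes>\<^bsub>R\<^esub> t'" "c \<otimes>\<^bsub>R\<^esub> s' \<in> T"
        by blast
      then obtain s r t q where el: "(s, r) \<in> X" "(t, q) \<in> Y" "s' = \<phi> s" "r' = \<phi> r" "t' = \<phi> t" "q' = \<phi> q"
        by (auto simp: h_def)
      have dom: "s \<in> S" "r \<in> carrier A" "t \<in> S" "q \<in> carrier A"
        using XY el(1,2) by blast+
      have "\<psi> c \<otimes> s = \<psi> d \<otimes> t" using el el' dom SA(1) by (simp add: \<psi>\<phi>)
      moreover have cs: "\<psi> c \<otimes> s \<in> S"
        using el(3) el'(3,6) SA(1)[OF dom(1)] mult \<psi> unfolding S by (simp add: hom(2))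
      moreover have "Z = h (frac A S (\<psi> c \<otimes> s) (\<psi> c \<otimes> r \<oplus> \<psi> d \<otimes> q))"
        using h_frac[OF cs, of "\<psi> c \<otimes> r \<oplus> \<psi> d \<otimes> q"] el(3-6) el'(3,4) dom SA(1) mult add \<psi>
        unfolding Z by (simp add: hom(2,3))
      moreover have "frac A S (\<psi> c \<otimes> s) (\<psi> c \<otimes> r \<oplus> \<psi> d \<otimes> q) \<in> ?L"
        using calculation(1) cs el(1,2) \<psi>(1)[OF el'(3)] \<psi>(1)[OF el'(4)] by blast
      ultimately show "Z \<in> h ` ?L" by (intro image_eqI)
    qed
    then show "h (X \<oplus>\<^bsub>left_localization A S\<^esub> Y) = h X \<oplus>\<^bsub>left_localization R T\<^esub> h Y"
      by (simp add: left_localization_def h_Union)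
  next
    show "h \<one>\<^bsub>left_localization A S\<^esub> = \<one>\<^bsub>left_localization R T\<^esub>"
      using h_frac[of \<one> \<one>] one_A hom(4) S by (simp add: left_localization_def)
  next
    have "inj_on h (carrier (left_localization A S))"
    proof (rule inj_onI)
      fix X Y
      assume "X \<in> carrier (left_localization A S)" "Y \<in> carrier (left_localization A S)"
      then obtain s r t q where X: "X = frac A S s r" "s \<in> S" "r \<in> carrier A"
        and Y: "Y = frac A S t q" "t \<in> S" "q \<in> carrier A"
        by (auto simp: carrier)
      assume "h X = h Y"
      then have eq: "frac R T (\<phi> s) (\<phi> r) = frac R T (\<phi> t) (\<phi> q)"
        using X Y h_frac by simp
      \<comment> \<open>A class over \<open>A\<close> is the full preimage, within
        \<open>S \<times> carrier A\<close>, of its image under \<open>h\<close>, so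
        \<open>h X\<close> determines \<open>X\<close>.\<close>
      have "(u, v) \<in> frac A S s' r' \<longleftrightarrow>
          u \<in> S \<and> v \<in> carrier A \<and> (\<phi> u, \<phi> v) \<in> frac R T (\<phi> s') (\<phi> r')"
        if "s' \<in> S" "r' \<in> carrier A" for s' r' u v
      proof (cases "u \<in> S \<and> v \<in> carrier A")
        case True
        then show ?thesis using rel[of s' r' u v] SA(1) that by (simp add: frac_def)
      next
        case False
        then show ?thesis using rel_dom[of s' r' u v] by (auto simp: frac_def)
      qed
      then have "p \<in> X \<longleftrightarrow> p \<in> Y" for p using X Y eq by (cases p) simp
      then show "X = Y" by blast
    qed
    moreover have "h ` carrier (left_localization A S) = carrier (left_localization R T)"
    proof (intro equalityI subsetI)
      fix Z assume "Z \<in> carrier (left_localization R T)"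
      then obtain s r where sr: "Z = frac R T s r" "s \<in> T" "r \<in> carrier R" by (auto simp: carrier)
      then have "Z = h (frac A S (\<psi> s) (\<psi> r))" using h_frac \<psi>S \<psi> by simp
      then show "Z \<in> h ` carrier (left_localization A S)"
        using sr \<psi>S \<psi>(1) unfolding carrier by blast
    qed (use h_frac SA hom(1) in \<open>fastforce simp: carrier\<close>)
    ultimately show "bij_betw h (carrier (left_localization A S)) (carrier (left_localization R T))"
      by (simp add: bij_betw_def)
  qed
  then show ?thesis unfolding is_ring_iso_def by blast
qed

section \<open>Upper triangular matrices\<close>

text \<open>This is $xE_{ij}$. For \<open>i = j = n\<close> it serves, as a function of
  \<open>x\<close>, as the section \<open>\<psi>\<close> of the map to the corner entry
  \<open>a n n\<close>.\<close>

definition matrix_unit :: "('a, 'm) ring_scheme \<Rightarrow> nat \<Rightarrow> nat \<Rightarrow> 'a \<Rightarrow> nat \<Rightarrow> nat \<Rightarrow> 'a" where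
  "matrix_unit R i j x = (\<lambda>k l. if k = i \<and> l = j then x else \<zero>\<^bsub>R\<^esub>)"

lemma (in abelian_monoid) finsum_single:
  assumes "i \<in> I" "finite I" "f i \<in> carrier G" "\<And>j. \<lbrakk>j \<in> I; j \<noteq> i\<rbrakk> \<Longrightarrow> f j = \<zero>"
  shows "finsum G f I = f i"
proof -
  have "finsum G f I = finsum G f {i}"
    using assms by (intro add.finprod_mono_neutral_cong_right) (auto, metis zero_closed)
  then show ?thesis using assms(3) by simp
qed

section \<open>Entries, products and matrix units of upper triangular matrices\<close>

context ring
begin

context
  fixes n :: nat
begin

abbreviation (input) U where "U \<equiv> upper_triangular_ring n R"

lemma UT_carrier:
  "a \<in> carrier U \<longleftrightarrow>
    (\<forall>i j. a i j \<in> carrier R) \<and> (\<forall>i j. \<not> (1 \<le> i \<and> i \<le> j \<and> j \<le> n) \<longrightarrow> a i j = \<zero>)"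
  by (simp add: upper_triangular_ring_def)

lemma UT_entry:
  assumes "a \<in> carrier U"
  shows "a i j \<in> carrier R" "i = 0 \<Longrightarrow> a i j = \<zero>" "j < i \<Longrightarrow> a i j = \<zero>" "n < j \<Longrightarrow> a i j = \<zero>"
  using assms by (auto simp: UT_carrier)

lemma UT_mult: "(a \<otimes>\<^bsub>U\<^esub> b) i j = (\<Oplus>k\<in>{1..n}. a i k \<otimes> b k j)"
  by (simp add: upper_triangular_ring_def)

lemma UT_zero: "\<zero>\<^bsub>U\<^esub> = (\<lambda>i j. \<zero>)"
  by (simp add: upper_triangular_ring_def)

lemma UT_add: "(a \<oplus>\<^bsub>U\<^esub> b) i j = a i j \<oplus> b i j"
  by (simp add: upper_triangular_ring_def)

lemma UT_one: "\<one>\<^bsub>U\<^esub> i j = (if i = j \<and> i \<in> {1..n} then \<one> else \<zero>)"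
  by (simp add: upper_triangular_ring_def)

lemma UT_one_closed: "\<one>\<^bsub>U\<^esub> \<in> carrier U"
  by (auto simp: UT_carrier UT_one)

lemma UT_add_closed: "\<lbrakk>a \<in> carrier U; b \<in> carrier U\<rbrakk> \<Longrightarrow> a \<oplus>\<^bsub>U\<^esub> b \<in> carrier U"
  by (simp add: UT_carrier UT_add)

lemma UT_mult_closed:
  assumes "a \<in> carrier U" "b \<in> carrier U"
  shows "a \<otimes>\<^bsub>U\<^esub> b \<in> carrier U"
  unfolding UT_carrier UT_mult
proof (intro conjI allI impI)
  fix i j
  show "(\<Oplus>k\<in>{1..n}. a i k \<otimes> b k j) \<in> carrier R"
    using assms by (intro finsum_closed) (auto simp: UT_entry)
  assume ij: "\<not> (1 \<le> i \<and> i \<le> j \<and> j \<le> n)"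
  \<comment> \<open>If \<open>k < i\<close> or \<open>i = 0\<close>, the factor \<open>a i k\<close>
    is zero; otherwise \<open>j < k\<close> or \<open>n < j\<close>, and \<open>b k j\<close> is
    zero.\<close>
  have "a i k \<otimes> b k j = \<zero>" for k
  proof (cases "k < i \<or> i = 0")
    case True
    then show ?thesis using UT_entry[OF assms(1)] UT_entry[OF assms(2)] by auto
  next
    case False
    then have "j < k \<or> n < j" using ij by auto
    then show ?thesis using UT_entry[OF assms(1)] UT_entry[OF assms(2)] by auto
  qed
  then show "(\<Oplus>k\<in>{1..n}. a i k \<otimes> b k j) = \<zero>" by (intro add.finprod_one_eqI) auto
qed

lemma matrix_unit_closed:
  "\<lbrakk>1 \<le> i; i \<le> j; j \<le> n; x \<in> carrier R\<rbrakk> \<Longrightarrow> matrix_unit R i j x \<in> carrier U"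
  by (auto simp: UT_carrier matrix_unit_def)

lemma mult_matrix_unit:
  assumes "a \<in> carrier U" "x \<in> carrier R" "1 \<le> i" "i \<le> n"
  shows "(a \<otimes>\<^bsub>U\<^esub> matrix_unit R i j x) k l = (if l = j then a k i \<otimes> x else \<zero>)"
proof -
  have "(a \<otimes>\<^bsub>U\<^esub> matrix_unit R i j x) k l = a k i \<otimes> matrix_unit R i j x i l"
    unfolding UT_mult using assms
    by (intro finsum_single) (auto simp: matrix_unit_def UT_entry)
  then show ?thesis using assms by (simp add: matrix_unit_def UT_entry)
qed

section \<open>The corner entry and left denominator sets\<close>

context
  assumes n: "1 \<le> n"
begin

text \<open>Row \<open>n\<close> of \<open>a\<close> vanishes off the diagonal, so only the summand
  \<open>k = n\<close> remains.\<close>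

lemma UT_mult_corner:
  assumes "a \<in> carrier U" "b \<in> carrier U"
  shows "(a \<otimes>\<^bsub>U\<^esub> b) n n = a n n \<otimes> b n n"
  unfolding UT_mult using n assms
  by (intro finsum_single) (auto simp: UT_entry)

lemma corner_hom: "(\<lambda>a. a n n) \<in> ring_hom U R"
  using n by (intro ring_hom_memI) (auto simp: UT_entry UT_mult_corner UT_add UT_one)

lemma corner_unit_closed: "x \<in> carrier R \<Longrightarrow> matrix_unit R n n x \<in> carrier U"
  using n by (simp add: matrix_unit_closed)

text \<open>Left multiplication by $xE_{nn}$ keeps only row \<open>n\<close> of \<open>a\<close>,
  and this row is zero outside column \<open>n\<close>. This is the compatibility
  \<open>\<psi>\<phi>\<close> required by \<open>left_localization_iso\<close>.\<close>

lemma corner_unit_mult: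
  assumes "x \<in> carrier R" "a \<in> carrier U"
  shows "matrix_unit R n n x \<otimes>\<^bsub>U\<^esub> a = matrix_unit R n n (x \<otimes> a n n)"
proof (intro ext)
  fix k l
  have "(matrix_unit R n n x \<otimes>\<^bsub>U\<^esub> a) k l = matrix_unit R n n x k n \<otimes> a n l"
    unfolding UT_mult using n assms
    by (intro finsum_single) (auto simp: matrix_unit_def UT_entry)
  also have "\<dots> = matrix_unit R n n (x \<otimes> a n n) k l"
    using assms UT_entry(3,4)[OF assms(2), of l n] UT_entry(4)[OF assms(2), of l n]
    by (cases l n rule: linorder_cases) (auto simp: matrix_unit_def UT_entry(1))
  finally show "(matrix_unit R n n x \<otimes>\<^bsub>U\<^esub> a) k l = matrix_unit R n n (x \<otimes> a n n) k l" .
qed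

lemma Den_l_corner_nonzero:
  assumes S: "S \<in> Den_l U" and s: "s \<in> S"
  shows "s n n \<noteq> \<zero>"
proof
  assume s0: "s n n = \<zero>"
  have ore: "left_ore_set U S" and "multiplicative_subset U S"
    and den: "\<And>r s. \<lbrakk>r \<in> carrier U; s \<in> S; r \<otimes>\<^bsub>U\<^esub> s = \<zero>\<^bsub>U\<^esub>\<rbrakk> \<Longrightarrow> r \<in> ass U S"
    using S by (auto simp: Den_l_def left_ore_set_def)
  then interpret S: submonoid S U by (simp add: multiplicative_subset_def)
  have zero: "\<zero>\<^bsub>U\<^esub> \<notin> S" using ore by (simp add: left_ore_set_def multiplicative_subset_def)
  have SU: "p \<in> carrier U" if "p \<in> S" for p using that S.subset by auto
  \<comment> \<open>The product is $s_{nn}E_{nn} = 0$, so the denominator condition puts $E_{nn}$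
    into \<open>ass U S\<close>.\<close>
  have "matrix_unit R n n \<one> \<otimes>\<^bsub>U\<^esub> s = \<zero>\<^bsub>U\<^esub>"
    using SU[OF s] s0 corner_unit_mult[of \<one> s] by (auto simp: UT_zero matrix_unit_def)
  then obtain t where t: "t \<in> S" "t \<otimes>\<^bsub>U\<^esub> matrix_unit R n n \<one> = \<zero>\<^bsub>U\<^esub>"
    using den s corner_unit_closed[of \<one>] by (auto simp: ass_def)
  \<comment> \<open>Right multiplication by $E_{nn}$ extracts the last column of
    \<open>t\<close>.\<close>
  have t_last: "t l n = \<zero>" for l
  proof -
    have "(t \<otimes>\<^bsub>U\<^esub> matrix_unit R n n \<one>) l n = t l n \<otimes> \<one>"
      using mult_matrix_unit[OF SU[OF t(1)] one_closed n] by simp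
    then show ?thesis using UT_entry(1)[OF SU[OF t(1)]] unfolding t(2) UT_zero by simp
  qed
  \<comment> \<open>In the Ore relation $pE_{kn} = bt$ the entry at \<open>(k, n)\<close> is
    \<open>p k k\<close> on the left, and zero on the right because the last column of
    \<open>t\<close> vanishes.\<close>
  have "\<exists>p\<in>S. p k k = \<zero>" if k: "1 \<le> k" "k \<le> n" for k
  proof -
    have "matrix_unit R k n \<one> \<in> carrier U" using k matrix_unit_closed by simp
    then have "(S #>\<^bsub>U\<^esub> matrix_unit R k n \<one>) \<inter> (carrier U #>\<^bsub>U\<^esub> t) \<noteq> {}"
      using ore t(1) by (simp add: left_ore_set_def)
    then obtain p b where p: "p \<in> S" and b: "b \<in> carrier U"
      and eq: "p \<otimes>\<^bsub>U\<^esub> matrix_unit R k n \<one> = b \<otimes>\<^bsub>U\<^esub> t"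
      by (auto simp: r_coset_def)
    have "p k k = (b \<otimes>\<^bsub>U\<^esub> t) k n"
      using mult_matrix_unit[OF SU[OF p] one_closed k, of n k n] UT_entry(1)[OF SU[OF p]]
      by (simp flip: eq)
    also have "\<dots> = \<zero>"
      unfolding UT_mult t_last using b by (intro add.finprod_one_eqI) (simp add: UT_entry)
    finally show ?thesis using p by blast
  qed
  then obtain p where p: "\<And>k. \<lbrakk>1 \<le> k; k \<le> n\<rbrakk> \<Longrightarrow> p k \<in> S \<and> p k k k = \<zero>" by metis
  \<comment> \<open>Multiplying by \<open>p 1\<close>, \<open>p 2\<close>, ... successively on the
    right clears one more column each time. For \<open>m = 0\<close> the claim concerns only column
    \<open>0\<close>, which lies outside the index range, so the identity will do.\<close>
  have "\<exists>q\<in>S. \<forall>i j. j \<le> m \<longrightarrow> q i j = \<zero>" if "m \<le> n" for m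
    using that
  proof (induction m)
    case 0
    have "\<forall>i j. j \<le> 0 \<longrightarrow> \<one>\<^bsub>U\<^esub> i j = \<zero>" by (auto simp: UT_one)
    then show ?case using S.one_closed by blast
  next
    case (Suc m)
    then obtain q where q: "q \<in> S" "\<And>i j. j \<le> m \<Longrightarrow> q i j = \<zero>" by auto
    define p' where "p' = p (Suc m)"
    have p': "p' \<in> S" "p' (Suc m) (Suc m) = \<zero>" using p[of "Suc m"] Suc.prems by (auto simp: p'_def)
    have "q i k \<otimes> p' k j = \<zero>" if "j \<le> Suc m" for i j k
    proof -
      \<comment> \<open>The cases use, in turn, the vanishing of column \<open>k\<close> of
        \<open>q\<close>, the zero diagonal entry of \<open>p'\<close>, and the triangular shape of
        \<open>p'\<close>.\<close>
      consider "k \<le> m" | "k = Suc m" "j = Suc m" | "j < k" using \<open>j \<le> Suc m\<close> by linarith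
      then show ?thesis
        using q(2)[of k i] p' UT_entry(1,3)[OF SU[OF p'(1)]] UT_entry(1)[OF SU[OF q(1)]] by cases auto
    qed
    then have "\<forall>i j. j \<le> Suc m \<longrightarrow> (q \<otimes>\<^bsub>U\<^esub> p') i j = \<zero>"
      unfolding UT_mult by (intro allI impI add.finprod_one_eqI) auto
    then show ?case using q(1) p'(1) S.m_closed by blast
  qed
  from this[of n] obtain q where q: "q \<in> S" "\<And>i j. j \<le> n \<Longrightarrow> q i j = \<zero>" by auto
  \<comment> \<open>Columns beyond \<open>n\<close> are zero by the encoding of matrices as
    functions.\<close>
  have "q i j = \<zero>" for i j
    using q(2)[of j i] UT_entry(4)[OF SU[OF q(1)], of j i] by (cases "j \<le> n") auto
  then have "q = \<zero>\<^bsub>U\<^esub>" unfolding UT_zero by (intro ext)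
  then show False using zero q(1) by simp
qed

end

end

end

section \<open>The set of matrices with nonzero corner entry\<close>

context nc_domain
begin

lemma submonoid_nonzero: "submonoid (carrier R - {\<zero>}) R"
  using integral one_not_zero by unfold_locales auto

text \<open>Left multiplication by \<open>s\<close> multiplies the corner by the nonzero
  \<open>s n n\<close>, which gives one inclusion in a domain. Conversely $E_{nn}$ itself has
  nonzero corner and annihilates from the left every \<open>a\<close> with zero corner.\<close>

lemma ass_corner_nonzero:
  assumes n: "1 \<le> n"
  shows "ass (upper_triangular_ring n R) {a \<in> carrier (upper_triangular_ring n R). a n n \<noteq> \<zero>} =
    {a \<in> carrier (upper_triangular_ring n R). a n n = \<zero>}"
proof (intro equalityI subsetI)
  fix a assume "a \<in> ass (upper_triangular_ring n R) {a \<in> carrier (upper_triangular_ring n R). a n n \<noteq> \<zero>}"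
  then obtain s where a: "a \<in> carrier (upper_triangular_ring n R)"
    and s: "s \<in> carrier (upper_triangular_ring n R)" "s n n \<noteq> \<zero>"
    and "s \<otimes>\<^bsub>upper_triangular_ring n R\<^esub> a = \<zero>\<^bsub>upper_triangular_ring n R\<^esub>"
    by (auto simp: ass_def)
  then have "s n n \<otimes> a n n = \<zero>" using UT_mult_corner[OF n s(1) a] by (simp add: UT_zero)
  then show "a \<in> {a \<in> carrier (upper_triangular_ring n R). a n n = \<zero>}"
    using a s integral UT_entry(1) by blast
next
  fix a assume "a \<in> {a \<in> carrier (upper_triangular_ring n R). a n n = \<zero>}"
  then have a: "a \<in> carrier (upper_triangular_ring n R)" "a n n = \<zero>" by auto
  then have "matrix_unit R n n \<one> \<otimes>\<^bsub>upper_triangular_ring n R\<^esub> a = \<zero>\<^bsub>upper_triangular_ring n R\<^esub>"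
    using corner_unit_mult[OF n, of \<one> a] by (auto simp: matrix_unit_def UT_zero)
  moreover have "matrix_unit R n n \<one> n n \<noteq> \<zero>" using one_not_zero by (simp add: matrix_unit_def)
  ultimately show "a \<in> ass (upper_triangular_ring n R) {a \<in> carrier (upper_triangular_ring n R). a n n \<noteq> \<zero>}"
    using a(1) corner_unit_closed[OF n one_closed] by (auto simp: ass_def)
qed

text \<open>Each condition reduces to \<open>R\<close> through the corner: closure to the absence of
  zero divisors, the Ore condition to that of \<open>R\<close>, and the denominator condition to the
  description of \<open>ass\<close> above.\<close>

lemma corner_nonzero_Den_l:
  assumes n: "1 \<le> n" and goldie: "left_goldie R"
  shows "{a \<in> carrier (upper_triangular_ring n R). a n n \<noteq> \<zero>} \<in> Den_l (upper_triangular_ring n R)"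
    (is "?S \<in> Den_l ?U")
proof -
  have "submonoid ?S ?U"
  proof
    fix x y assume "x \<in> ?S" "y \<in> ?S"
    then show "x \<otimes>\<^bsub>?U\<^esub> y \<in> ?S"
      using UT_mult_closed[of x n y] UT_mult_corner[OF n, of x y] integral[of "x n n" "y n n"]
        UT_entry(1)[of x n] UT_entry(1)[of y n] by auto
  qed (use n one_not_zero UT_one_closed in \<open>auto simp: UT_one\<close>)
  then have "multiplicative_subset ?U ?S" by (simp add: multiplicative_subset_def UT_zero)
  moreover have "(?S #>\<^bsub>?U\<^esub> r) \<inter> (carrier ?U #>\<^bsub>?U\<^esub> s) \<noteq> {}" if r: "r \<in> carrier ?U" and s: "s \<in> ?S" for r s
  proof -
    obtain u v where uv: "u \<in> carrier R" "v \<in> carrier R" "u \<noteq> \<zero>" "u \<otimes> r n n = v \<otimes> s n n"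
      using left_goldie_imp_left_ore[OF goldie, of "r n n" "s n n"] r s UT_entry(1) by blast
    \<comment> \<open>Both sides carry the common multiple
      \<open>u \<otimes> r n n = v \<otimes> s n n\<close> in the corner and zero elsewhere.\<close>
    then have "matrix_unit R n n u \<otimes>\<^bsub>?U\<^esub> r = matrix_unit R n n v \<otimes>\<^bsub>?U\<^esub> s"
      using corner_unit_mult[OF n] r s by simp
    moreover have "matrix_unit R n n u \<in> ?S" "matrix_unit R n n v \<in> carrier ?U"
      using uv corner_unit_closed[OF n] by (auto simp: matrix_unit_def)
    ultimately show ?thesis unfolding r_coset_def by blast
  qed
  moreover have "r \<in> ass ?U ?S" if r: "r \<in> carrier ?U" and s: "s \<in> ?S" and "r \<otimes>\<^bsub>?U\<^esub> s = \<zero>\<^bsub>?U\<^esub>" for r s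
  proof -
    have "r n n \<otimes> s n n = \<zero>" using UT_mult_corner[OF n, of r s] that by (simp add: UT_zero)
    then have "r n n = \<zero>" using integral[of "r n n" "s n n"] r s UT_entry(1) by auto
    then show ?thesis using r unfolding ass_corner_nonzero[OF n] by simp
  qed
  ultimately show ?thesis unfolding Den_l_def left_ore_set_def by blast
qed

end

text \<open>A greatest left denominator set is the only maximal one, so \<open>Ls_l A\<close> is
  \<open>S\<close> itself, and \<open>S\<close> is the largest member of the union defining
  \<open>T_l A\<close>.\<close>

lemma greatest_Den_l:
  assumes "S \<in> Den_l A" "\<And>S'. S' \<in> Den_l A \<Longrightarrow> S' \<subseteq> S"
  shows "max_Den_l A = {S}" "T_l A = S"
proof -
  show max: "max_Den_l A = {S}"
  proof (intro equalityI subsetI)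
    fix S' assume "S' \<in> max_Den_l A"
    then have "S' \<in> Den_l A" "\<forall>S''\<in>Den_l A. S' \<subseteq> S'' \<longrightarrow> S'' = S'"
      by (simp_all add: max_Den_l_def)
    then have "S = S'" using assms(1) assms(2)[of S'] by blast
    then show "S' \<in> {S}" by simp
  next
    fix S' assume "S' \<in> {S}"
    moreover have "S'' = S" if "S'' \<in> Den_l A" "S \<subseteq> S''" for S''
      using assms(2)[OF that(1)] that(2) by (rule subset_antisym)
    ultimately show "S' \<in> max_Den_l A" using assms(1) by (simp add: max_Den_l_def)
  qed
  show "T_l A = S" using assms(1) by (auto simp: T_l_def Ls_l_def max)
qed

theorem theorem5p3:
  fixes R :: "('a, 'm) ring_scheme" and n :: nat
  assumes "nc_domain R" and "left_goldie R" and "n \<ge> 1"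
  shows "max_Den_l (upper_triangular_ring n R) = {T_l (upper_triangular_ring n R)} \<and>
         T_l (upper_triangular_ring n R) =
           {a \<in> carrier (upper_triangular_ring n R). a n n \<noteq> \<zero>\<^bsub>R\<^esub>} \<and>
         ls_ideal (upper_triangular_ring n R) =
           {a \<in> carrier (upper_triangular_ring n R). a n n = \<zero>\<^bsub>R\<^esub>} \<and>
         Qs_l (upper_triangular_ring n R) \<simeq> Q_lcl R"
proof -
  interpret nc_domain R by fact
  let ?U = "upper_triangular_ring n R"
  let ?S = "{a \<in> carrier ?U. a n n \<noteq> \<zero>\<^bsub>R\<^esub>}"
  note S = corner_nonzero_Den_l[OF assms(3,2)]
  have "S' \<subseteq> ?S" if "S' \<in> Den_l ?U" for S'
  proof -
    have "S' \<subseteq> carrier ?U"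
      using that by (simp add: Den_l_def left_ore_set_def multiplicative_subset_def submonoid.subset)
    then show ?thesis using Den_l_corner_nonzero[OF assms(3) that] by blast
  qed
  note max = greatest_Den_l[OF S this]
  have "left_localization ?U ?S \<simeq> left_localization R (carrier R - {\<zero>\<^bsub>R\<^esub>})"
  proof (rule left_localization_iso[where \<phi> = "\<lambda>a. a n n" and \<psi> = "matrix_unit R n n"])
    show "matrix_unit R n n x \<otimes>\<^bsub>?U\<^esub> a = matrix_unit R n n (x \<otimes>\<^bsub>R\<^esub> a n n)"
      if "x \<in> carrier R" "a \<in> carrier ?U" for x a
      using that by (rule corner_unit_mult[OF assms(3)])
    \<comment> \<open>Entries always lie in \<open>carrier R\<close>, so \<open>?S\<close> is the
      full preimage of the nonzero elements under the corner map.\<close>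
    show "?S = {a \<in> carrier ?U. a n n \<in> carrier R - {\<zero>\<^bsub>R\<^esub>}}" using UT_entry(1) by auto
    show "matrix_unit R n n x n n = x" for x by (simp add: matrix_unit_def)
  qed (simp_all add: ring_axioms submonoid_nonzero UT_one_closed UT_mult_closed UT_add_closed
      corner_hom[OF assms(3)] corner_unit_closed[OF assms(3)])
  then show ?thesis
    using max ass_corner_nonzero[OF assms(3)] by (simp add: ls_ideal_def Qs_l_def Q_lcl_def)
qed

end
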